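(* Let $\mathcal{K}_0\subset\ldots\subset\mathcal{K}_n=\mathcal{K}$ be a filtered complex and let $\mathcal{A}_0\subset\ldots\subset\mathcal{A}_n=\mathcal{A}$, where $\mathcal{A}_i=\mathcal{K}_i\cap\mathcal{A}$, be an acyclic subcomplex compatible with the filtration. Then for every $l>0$ the $l$-dimensional persistent homologies of $\mathcal{K}$ (filtered by the $\mathcal{K}_i$) and of $\mathcal{K}\setminus\mathcal{A}$ (filtered by the $\mathcal{K}_i\setminus\mathcal{A}_i$) are the same.
   Context: Chain complexes. A (finite) complex $\mathcal{K}$ over $\mathbb{Z}_2$ is a finite set of abstract cells (for example the cells of a simplicial or cubical complex), each with a dimension $p\ge 0$. Let $C_p(\mathcal{K})$ be the $\mathbb{Z}_2$-vector space with basis the $p$-cells of $\mathcal{K}$. There are linear boundary operators $\partial_p:C_p(\mathcal{K})\to C_{p-1}(\mathcal{K})$ (with $\partial_0=0$) satisfying $\partial_p\circ\partial_{p+1}=0$. Homology is $H_p(\mathcal{K})=\ker\partial_p/\operatorname{im}\partial_{p+1}$. A $(p-1)$-cell $a$ is a face of a $p$-cell $B$ if $a$ appears with nonzero coefficient in $\partial B$. A subset $\mathcal{A}\subset\mathcal{K}$ is closed, or a subcomplex, if it contains every face of each of its cells. Filtrations. A filtering function is a map $g:\mathcal{K}\to\mathbb{Z}$ with $g(a)\le g(B)$ whenever $a$ is a face of $B$; here its values lie in $\{0,\ldots,n\}$ and $\mathcal{K}_i=\{c\in\mathcal{K}:g(c)\le i\}$, which is a subcomplex of $\mathcal{K}$.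 The complex $\mathcal{K}$ with the subcomplexes $\mathcal{K}_0\subset\ldots\subset\mathcal{K}_n=\mathcal{K}$ is called a filtered complex. Acyclic subcomplexes. A subcomplex $\mathcal{A}$ of a complex $\mathcal{K}$ is an acyclic subcomplex in $\mathcal{K}$ if $H_p(\mathcal{A})=0$ for all $p>0$ and $H_0(\mathcal{A})\cong\mathbb{Z}_2^m$, where $m$ is the number of connected components of $\mathcal{K}$. A subcomplex $\mathcal{A}$ of the filtered complex $\mathcal{K}_0\subset\ldots\subset\mathcal{K}_n=\mathcal{K}$ is an acyclic subcomplex compatible with the filtration if $\mathcal{A}_i=\mathcal{K}_i\cap\mathcal{A}$ is an acyclic subcomplex in $\mathcal{K}_i$ for every $i\in\{0,\ldots,n\}$. Removal of cells. $\mathcal{K}\setminus\mathcal{A}$ is the set of cells obtained by deleting the cells of $\mathcal{A}$, with boundary operator obtained from that of $\mathcal{K}$ by deleting all terms involving the removed cells; since $\mathcal{A}$ is closed this is again a chain complex. The same applies to $\mathcal{K}_i\setminus\mathcal{A}_i=\mathcal{K}_i\setminus\mathcal{A}$, which is a subcomplex of $\mathcal{K}\setminus\mathcal{A}$. Persistence. For a filtered complex $X_0\subset\ldots\subset X_n$ and $i\le j$, the $p$-th persistent homology groups are the images $\operatorname{im}\big(H_p(X_i)\to H_p(X_j)\big)$ of the maps induced by inclusion $X_i\hookrightarrow X_j$. The persistence of $X$ in dimension $p$ is represented by the multiset of persistence intervals (birth, death) of homology classes, zero-length intervals being disregarded. Two filtered complexes have the same persistent homology in dimension $p$ if these multisets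 of intervals coincide.
   Formalization: Acyclic subcomplexes are also required to have H_0(A_i) → H_0(K_i), induced by inclusion, injective. Without this the claim fails: for K = an edge with ends u, v plus an isolated vertex and A = {u, v}, H_1(K) = 0 but H_1(K∖A) = Z_2. *)

theory Defs
  imports
    "HOL-Algebra.Product_Groups"
    "HOL-Library.Z2"
    "HOL-Library.Multiset"
    "HOL-Library.Extended_Nat"
begin

text \<open>A finite complex over the field \<open>bit\<close> with two elements. \<open>inc K B a\<close> is the coefficient of
  the cell \<open>a\<close> in the boundary of the cell \<open>B\<close>; only its values on cells of \<open>K\<close> matter, so that
  shrinking \<open>cells\<close> automatically deletes all terms that involve removed cells.\<close>

record 'c cell_complex =
  cells :: "'c set"
  cdim :: "'c \<Rightarrow> nat"
  inc :: "'c \<Rightarrow> 'c \<Rightarrow> bit"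

definition chains :: "'c cell_complex \<Rightarrow> nat \<Rightarrow> ('c \<Rightarrow> bit) set" where
  "chains K p = {x. \<forall>a. x a \<noteq> 0 \<longrightarrow> a \<in> cells K \<and> cdim K a = p}"

definition boundary :: "'c cell_complex \<Rightarrow> ('c \<Rightarrow> bit) \<Rightarrow> 'c \<Rightarrow> bit" where
  "boundary K x = (\<lambda>a. if a \<in> cells K then \<Sum>B\<in>cells K. x B * inc K B a else 0)"

text \<open>The second condition says that the boundary maps \<open>p\<close>-chains to \<open>(p-1)\<close>-chains, and
  \<open>0\<close>-chains to \<open>0\<close>.\<close>

definition chain_complex :: "'c cell_complex \<Rightarrow> bool" where
  "chain_complex K \<longleftrightarrow>
     finite (cells K) \<and>
     (\<forall>B\<in>cells K. \<forall>a\<in>cells K. inc K B a \<noteq> 0 \<longrightarrow> cdim K B = Suc (cdim K a)) \<and>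
     (\<forall>p. \<forall>x\<in>chains K p. boundary K (boundary K x) = (\<lambda>_. 0))"

definition is_face :: "'c cell_complex \<Rightarrow> 'c \<Rightarrow> 'c \<Rightarrow> bool" where
  "is_face K a B \<longleftrightarrow> a \<in> cells K \<and> B \<in> cells K \<and> inc K B a \<noteq> 0"

definition closed_in :: "'c cell_complex \<Rightarrow> 'c set \<Rightarrow> bool" where
  "closed_in K A \<longleftrightarrow> A \<subseteq> cells K \<and> (\<forall>B\<in>A. \<forall>a. is_face K a B \<longrightarrow> a \<in> A)"

definition restrict_to :: "'c cell_complex \<Rightarrow> 'c set \<Rightarrow> 'c cell_complex" where
  "restrict_to K A = K\<lparr>cells := A\<rparr>"

definition remove_cells :: "'c cell_complex \<Rightarrow> 'c set \<Rightarrow> 'c cell_complex" where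
  "remove_cells K A = K\<lparr>cells := cells K - A\<rparr>"

text \<open>Cells are in the same component iff they are joined by a chain of face relations.\<close>

definition components :: "'c cell_complex \<Rightarrow> 'c set set" where
  "components K =
     cells K // Restr ({(a, B). is_face K a B \<or> is_face K B a}\<^sup>*) (cells K)"


text \<open>The vector spaces over \<open>bit\<close> below are treated as additive groups; this loses nothing, since
  every group homomorphism between them is linear.\<close>

definition cycle_group :: "'c cell_complex \<Rightarrow> nat \<Rightarrow> ('c \<Rightarrow> bit) monoid" where
  "cycle_group K p =
     \<lparr>carrier = {x \<in> chains K p. boundary K x = (\<lambda>_. 0)},
      monoid.mult = (\<lambda>x y a. x a + y a), one = (\<lambda>_. 0)\<rparr>"

definition boundaries :: "'c cell_complex \<Rightarrow> nat \<Rightarrow> ('c \<Rightarrow> bit) set" where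
  "boundaries K p = boundary K ` chains K (Suc p)"

definition homology_group :: "'c cell_complex \<Rightarrow> nat \<Rightarrow> ('c \<Rightarrow> bit) set monoid" where
  "homology_group K p = cycle_group K p Mod boundaries K p"

text \<open>The map in homology induced by the inclusion of a subcomplex \<open>X\<close> of \<open>Y\<close>: it sends the class
  \<open>z + B\<^sub>p(X)\<close> to \<open>B\<^sub>p(Y) + (z + B\<^sub>p(X)) = z + B\<^sub>p(Y)\<close>, so only the target has to be named.\<close>

definition incl_hom ::
    "'c cell_complex \<Rightarrow> nat \<Rightarrow> ('c \<Rightarrow> bit) set \<Rightarrow> ('c \<Rightarrow> bit) set" where
  "incl_hom Y p C = boundaries Y p <#>\<^bsub>cycle_group Y p\<^esub> C"

definition Z2_power :: "nat \<Rightarrow> (nat \<Rightarrow> int) monoid" where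
  "Z2_power m = product_group {..<m} (\<lambda>_. integer_mod_group 2)"

text \<open>In the last clause of the next definition the isomorphism between \<open>H\<^sub>0(A)\<close> and the power of
  \<open>\<int>\<^sub>2\<close> is required to be compatible with inclusion. For simplicial or cubical complexes the clauses together say that
  \<open>A\<close> has exactly one connected component in each component of \<open>K\<close>. The number \<open>m\<close> alone does not
  ensure this: let \<open>K\<close> consist of an edge with its end points \<open>u\<close>, \<open>v\<close> and of an isolated vertex, and
  let \<open>A = {u, v}\<close>. Then \<open>m = 2\<close> and \<open>H\<^sub>0(A)\<close> has dimension 2, but removing \<open>A\<close> creates a
  one-dimensional homology class.\<close>

definition acyclic_subcomplex :: "'c cell_complex \<Rightarrow> 'c set \<Rightarrow> bool" where
  "acyclic_subcomplex K A \<longleftrightarrow>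
     closed_in K A \<and>
     (\<forall>p>0. trivial_group (homology_group (restrict_to K A) p)) \<and>
     homology_group (restrict_to K A) 0 \<cong> Z2_power (card (components K)) \<and>
     inj_on (incl_hom K 0) (carrier (homology_group (restrict_to K A) 0))"


definition filtering_function :: "'c cell_complex \<Rightarrow> nat \<Rightarrow> ('c \<Rightarrow> int) \<Rightarrow> bool" where
  "filtering_function K n g \<longleftrightarrow>
     (\<forall>c\<in>cells K. g c \<in> {0..int n}) \<and> (\<forall>a B. is_face K a B \<longrightarrow> g a \<le> g B)"

definition sublevel :: "'c cell_complex \<Rightarrow> ('c \<Rightarrow> int) \<Rightarrow> nat \<Rightarrow> 'c cell_complex" where
  "sublevel K g i = restrict_to K {c \<in> cells K. g c \<le> int i}"

definition acyclic_compatible ::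
    "'c cell_complex \<Rightarrow> nat \<Rightarrow> ('c \<Rightarrow> int) \<Rightarrow> 'c set \<Rightarrow> bool" where
  "acyclic_compatible K n g A \<longleftrightarrow>
     closed_in K A \<and>
     (\<forall>i\<le>n. acyclic_subcomplex (sublevel K g i) (cells (sublevel K g i) \<inter> A))"


definition persistent_homology_group ::
    "'c cell_complex \<Rightarrow> 'c cell_complex \<Rightarrow> nat \<Rightarrow> ('c \<Rightarrow> bit) set monoid" where
  "persistent_homology_group X Y p =
     (homology_group Y p)\<lparr>carrier := incl_hom Y p ` carrier (homology_group X p)\<rparr>"

text \<open>Dimension of a finite-dimensional vector space over \<open>bit\<close>.\<close>

definition Z2_dim :: "('a, 'b) monoid_scheme \<Rightarrow> nat" where
  "Z2_dim G = (THE d. G \<cong> Z2_power d)"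

definition persistent_betti :: "(nat \<Rightarrow> 'c cell_complex) \<Rightarrow> nat \<Rightarrow> nat \<Rightarrow> nat \<Rightarrow> nat" where
  "persistent_betti X p i j = Z2_dim (persistent_homology_group (X i) (X j) p)"

text \<open>Number of independent classes at stage \<open>j\<close> that exist at stage \<open>i\<close> but not before;
  the image of the zero homology at stage \<open>-1\<close> has dimension 0.\<close>

definition born_alive :: "(nat \<Rightarrow> 'c cell_complex) \<Rightarrow> nat \<Rightarrow> nat \<Rightarrow> nat \<Rightarrow> nat" where
  "born_alive X p i j =
     persistent_betti X p i j - (if i = 0 then 0 else persistent_betti X p (i - 1) j)"

text \<open>The persistence intervals of \<open>X\<^sub>0 \<subseteq> \<dots> \<subseteq> X\<^sub>n\<close>, with death \<open>\<infinity>\<close> for classes that survive in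
  \<open>X\<^sub>n\<close>. The multiplicity of \<open>(i, j)\<close> is the number of independent classes born at \<open>i\<close> that are alive
  at \<open>j - 1\<close> but no longer at \<open>j\<close>; intervals with \<open>i = j\<close> are left out. The differences of natural
  numbers are never truncated for a filtered complex.\<close>

definition persistence ::
    "(nat \<Rightarrow> 'c cell_complex) \<Rightarrow> nat \<Rightarrow> nat \<Rightarrow> (nat \<times> enat) multiset" where
  "persistence X n p =
     (\<Sum>i\<le>n. \<Sum>j\<in>{i<..n}.
        replicate_mset (born_alive X p i (j - 1) - born_alive X p i j) (i, enat j)) +
     (\<Sum>i\<le>n. replicate_mset (born_alive X p i n) (i, \<infinity>))"

end

(* For l > 0 the long exact sequence of the pair (K_j, A_j) makes the restriction map
   H_l(K_j) -> H_l(K_j - A_j) an isomorphism: A_j has no homology in positive dimension, and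
   H_0(A_j) -> H_0(K_j) is injective, which is what the case l = 1 needs. Concretely, for i <= j
   both l-th persistent homology groups are images of the cycles Z_l(K_i), under
   z |-> z + B_l(K_j) and z |-> (z restricted to K_i - A_i) + B_l(K_j - A_j), and the two maps
   have the same kernel. *)
theory Submission
  imports Defs
begin

text \<open>These simplification rules turn the field operations of \<open>bit\<close> into bitwise
  ones and \<open>a \<noteq> 0\<close> into \<open>a = 1\<close>, out of reach of the general facts
  about rings and finite sums.\<close>

declare bit_not_zero_iff [simp del] add_bit_eq_xor [simp del] mult_bit_eq_and [simp del]

lemma bit_add_self [simp]: "(a :: bit) + a = 0"
  by (cases a) auto

section \<open>Chains of subcomplexes and of their complements\<close>

text \<open>The projection of C(K) onto C(K)/C(A), where the quotient is modelled by the chains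
  supported outside \<open>A\<close>.\<close>

definition remove_part :: "'c set \<Rightarrow> ('c \<Rightarrow> bit) \<Rightarrow> 'c \<Rightarrow> bit" where
  "remove_part A x = (\<lambda>a. if a \<in> A then 0 else x a)"

lemma remove_part_zero [simp]: "remove_part A (\<lambda>_. 0) = (\<lambda>_. 0)"
  by (simp add: remove_part_def)

lemma remove_part_add:
  "remove_part A (\<lambda>a. x a + y a) = (\<lambda>a. remove_part A x a + remove_part A y a)"
  by (auto simp: remove_part_def)

lemma cells_restrict_to [simp]: "cells (restrict_to K S) = S"
  and cdim_restrict_to [simp]: "cdim (restrict_to K S) = cdim K"
  and inc_restrict_to [simp]: "inc (restrict_to K S) = inc K"
  and restrict_to_restrict_to [simp]: "restrict_to (restrict_to K S) T = restrict_to K T"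
  and cells_remove_cells [simp]: "cells (remove_cells K A) = cells K - A"
  and cdim_remove_cells [simp]: "cdim (remove_cells K A) = cdim K"
  and inc_remove_cells [simp]: "inc (remove_cells K A) = inc K"
  by (simp_all add: restrict_to_def remove_cells_def)

lemma zero_in_chains [simp]: "(\<lambda>_. 0) \<in> chains K p"
  by (simp add: chains_def)

lemma chains_add: "x \<in> chains K p \<Longrightarrow> y \<in> chains K p \<Longrightarrow> (\<lambda>a. x a + y a) \<in> chains K p"
  unfolding chains_def by force

lemma chains_restrict_to_subset: "S \<subseteq> cells K \<Longrightarrow> chains (restrict_to K S) p \<subseteq> chains K p"
  by (auto simp: chains_def)

lemma chains_remove_cells_subset: "chains (remove_cells K A) p \<subseteq> chains K p"
  by (auto simp: chains_def)

lemma remove_part_chains: "x \<in> chains K p \<Longrightarrow> remove_part A x \<in> chains (remove_cells K A) p"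
  by (auto simp: chains_def remove_part_def)

lemma remove_part_id: "x \<in> chains (remove_cells K A) p \<Longrightarrow> remove_part A x = x"
  by (fastforce simp: chains_def remove_part_def)

lemma chains_restrict_toI:
  assumes "x \<in> chains K p" "remove_part A x = (\<lambda>_. 0)"
  shows "x \<in> chains (restrict_to K A) p"
  using assms by (force simp: chains_def remove_part_def fun_eq_iff split: if_splits)

lemma boundary_zero [simp]: "boundary K (\<lambda>_. 0) = (\<lambda>_. 0)"
  by (auto simp: boundary_def)

lemma boundary_add:
  "boundary K (\<lambda>a. x a + y a) = (\<lambda>a. boundary K x a + boundary K y a)"
  by (auto simp: boundary_def distrib_right sum.distrib)

lemma inc_nonzero_dim:
  "chain_complex K \<Longrightarrow> B \<in> cells K \<Longrightarrow> a \<in> cells K \<Longrightarrow> inc K B a \<noteq> 0 \<Longrightarrow> cdim K B = Suc (cdim K a)"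
  unfolding chain_complex_def by blast

lemma boundary_chains:
  assumes K: "chain_complex K" and x: "x \<in> chains K (Suc p)"
  shows "boundary K x \<in> chains K p"
proof -
  have "a \<in> cells K \<and> cdim K a = p" if "boundary K x a \<noteq> 0" for a
  proof -
    have a: "a \<in> cells K" and "(\<Sum>B\<in>cells K. x B * inc K B a) \<noteq> 0"
      using that unfolding boundary_def by presburger+
    then obtain B where B: "B \<in> cells K" "x B * inc K B a \<noteq> 0"
      by (blast elim: sum.not_neutral_contains_not_neutral)
    then have "x B \<noteq> 0" "inc K B a \<noteq> 0"
      using mult_not_zero by blast+
    then have "cdim K B = Suc p" "cdim K B = Suc (cdim K a)"
      using x inc_nonzero_dim[OF K B(1) a] unfolding chains_def by blast+
    then show ?thesis
      using a by simp
  qed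
  then show ?thesis
    unfolding chains_def by blast
qed

lemma boundary_chains_0:
  assumes K: "chain_complex K" and x: "x \<in> chains K 0"
  shows "boundary K x = (\<lambda>_. 0)"
proof -
  have "x B * inc K B a = 0" if "B \<in> cells K" "a \<in> cells K" for a B
  proof (rule ccontr)
    assume "x B * inc K B a \<noteq> 0"
    then have "x B \<noteq> 0" "inc K B a \<noteq> 0"
      using mult_not_zero by blast+
    then have "cdim K B = 0" "cdim K B = Suc (cdim K a)"
      using x inc_nonzero_dim[OF K that] unfolding chains_def by blast+
    then show False
      by simp
  qed
  then have "(\<Sum>B\<in>cells K. x B * inc K B a) = 0" if "a \<in> cells K" for a
    using that by (intro sum.neutral) blast
  then show ?thesis
    by (auto simp: boundary_def)
qed

lemma boundary_boundary:
  "chain_complex K \<Longrightarrow> x \<in> chains K p \<Longrightarrow> boundary K (boundary K x) = (\<lambda>_. 0)"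
  by (auto simp: chain_complex_def)

text \<open>The sum over \<open>S\<close> loses nothing because \<open>x\<close> vanishes off
  \<open>S\<close>. At a cell outside \<open>S\<close> both sides are zero, since closedness keeps
  every face of a cell of \<open>S\<close> inside \<open>S\<close>.\<close>

lemma boundary_restrict_to:
  assumes K: "chain_complex K" and S: "closed_in K S" and x: "x \<in> chains (restrict_to K S) p"
  shows "boundary (restrict_to K S) x = boundary K x"
proof
  fix a
  have SK: "S \<subseteq> cells K" and fin: "finite (cells K)"
    using K S by (auto simp: closed_in_def chain_complex_def)
  have 0: "x B = 0" if "B \<notin> S" for B
    using x that by (auto simp: chains_def)
  have sum_eq: "(\<Sum>B\<in>S. x B * inc K B a) = (\<Sum>B\<in>cells K. x B * inc K B a)"
    using fin SK 0 by (intro sum.mono_neutral_left) auto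
  have "(\<Sum>B\<in>S. x B * inc K B a) = 0" if "a \<in> cells K" "a \<notin> S"
    using S that unfolding closed_in_def is_face_def
    by (intro sum.neutral ballI) (metis mult_zero_right subsetD)
  then show "boundary (restrict_to K S) x a = boundary K x a"
    using sum_eq SK by (auto simp: boundary_def)
qed

text \<open>The projection is a chain map: a cell outside \<open>A\<close> is never a face of a cell
  of \<open>A\<close>, so the terms deleted from the sum were already zero.\<close>

lemma boundary_remove_cells:
  assumes K: "chain_complex K" and A: "closed_in K A"
  shows "boundary (remove_cells K A) (remove_part A x) = remove_part A (boundary K x)"
proof
  fix a
  have fin: "finite (cells K)"
    using K by (auto simp: chain_complex_def)
  have "(\<Sum>B\<in>cells K - A. remove_part A x B * inc K B a) = (\<Sum>B\<in>cells K. x B * inc K B a)"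
    if "a \<in> cells K" "a \<notin> A"
  proof (rule sum.mono_neutral_cong_left[OF fin])
    show "\<forall>B\<in>cells K - (cells K - A). x B * inc K B a = 0"
      using A that unfolding closed_in_def is_face_def
      by (metis Diff_Diff_Int IntE mult_zero_right)
  qed (auto simp: remove_part_def)
  then show "boundary (remove_cells K A) (remove_part A x) a = remove_part A (boundary K x) a"
    by (auto simp: boundary_def remove_part_def)
qed

lemma chain_complex_restrict_to:
  assumes K: "chain_complex K" and S: "closed_in K S"
  shows "chain_complex (restrict_to K S)"
proof -
  have SK: "S \<subseteq> cells K"
    using S by (simp add: closed_in_def)
  have dims: "\<forall>B\<in>cells (restrict_to K S). \<forall>a\<in>cells (restrict_to K S).
    inc (restrict_to K S) B a \<noteq> 0 \<longrightarrow> cdim (restrict_to K S) B = Suc (cdim (restrict_to K S) a)"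
    using inc_nonzero_dim[OF K] SK by auto
  have "boundary (restrict_to K S) (boundary (restrict_to K S) x) = (\<lambda>_. 0)"
    if x: "x \<in> chains (restrict_to K S) p" for p x
  proof (cases p)
    case 0
    then have "boundary K x = (\<lambda>_. 0)"
      using boundary_chains_0[OF K] x chains_restrict_to_subset[OF SK] by blast
    then show ?thesis
      by (simp add: boundary_restrict_to[OF K S x])
  next
    case (Suc q)
    have bK: "boundary K x \<in> chains K q"
      using boundary_chains[OF K] x chains_restrict_to_subset[OF SK] Suc by blast
    \<comment> \<open>The boundary inside \<open>S\<close> is zero off \<open>S\<close> by
      definition, and it agrees with the boundary in \<open>K\<close>; so
      \<open>boundary K x\<close> is again a chain on \<open>S\<close>.\<close>
    have "boundary K x a = 0" if "a \<notin> S" for a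
      using that boundary_restrict_to[OF K S x] by (metis boundary_def cells_restrict_to)
    then have "boundary K x \<in> chains (restrict_to K S) q"
      using bK by (force simp: chains_def)
    then show ?thesis
      using boundary_restrict_to[OF K S] boundary_boundary[OF K] x
        chains_restrict_to_subset[OF SK] by (metis subsetD)
  qed
  then show ?thesis
    using dims K SK by (auto simp: chain_complex_def intro: finite_subset)
qed

text \<open>A chain outside \<open>A\<close> is its own projection, so applying the chain map
  property twice turns its double boundary into the projection of a double boundary in
  \<open>K\<close>.\<close>

lemma chain_complex_remove_cells:
  assumes K: "chain_complex K" and A: "closed_in K A"
  shows "chain_complex (remove_cells K A)"
proof -
  have "boundary (remove_cells K A) (boundary (remove_cells K A) x) = (\<lambda>_. 0)"
    if x: "x \<in> chains (remove_cells K A) p" for p x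
    using boundary_remove_cells[OF K A] boundary_boundary[OF K] remove_part_id[OF x]
      x chains_remove_cells_subset by (metis remove_part_zero subsetD)
  then show ?thesis
    using K by (auto simp: chain_complex_def)
qed

section \<open>Cycles, boundaries and inclusions\<close>

lemma carrier_cycle_group:
  "z \<in> carrier (cycle_group K p) \<longleftrightarrow> z \<in> chains K p \<and> boundary K z = (\<lambda>_. 0)"
  and mult_cycle_group [simp]: "x \<otimes>\<^bsub>cycle_group K p\<^esub> y = (\<lambda>a. x a + y a)"
  and one_cycle_group [simp]: "\<one>\<^bsub>cycle_group K p\<^esub> = (\<lambda>_. 0)"
  by (auto simp: cycle_group_def)

lemma comm_group_cycle_group: "comm_group (cycle_group K p)"
proof (rule comm_groupI)
  fix x assume "x \<in> carrier (cycle_group K p)"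
  then show "\<exists>y\<in>carrier (cycle_group K p). y \<otimes>\<^bsub>cycle_group K p\<^esub> x = \<one>\<^bsub>cycle_group K p\<^esub>"
    \<comment> \<open>Over \<open>bit\<close> every chain is its own inverse.\<close>
    by (intro bexI[of _ x]) auto
qed (auto simp: carrier_cycle_group chains_add boundary_add algebra_simps)

lemma inv_cycle_group:
  assumes "x \<in> carrier (cycle_group K p)"
  shows "inv\<^bsub>cycle_group K p\<^esub> x = x"
  using assms comm_group_cycle_group[of K p]
  by (intro group.inv_equality) (auto simp: comm_group_def)

lemma boundaries_add:
  "x \<in> boundaries K p \<Longrightarrow> y \<in> boundaries K p \<Longrightarrow> (\<lambda>a. x a + y a) \<in> boundaries K p"
  by (auto simp: boundaries_def boundary_add[symmetric] chains_add)

lemma zero_in_boundaries [simp]: "(\<lambda>_. 0) \<in> boundaries K p"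
  unfolding boundaries_def by (rule image_eqI[of _ _ "\<lambda>_. 0"]) auto

lemma boundaries_cycles:
  "chain_complex K \<Longrightarrow> boundaries K p \<subseteq> carrier (cycle_group K p)"
  by (auto simp: boundaries_def carrier_cycle_group boundary_chains boundary_boundary)

lemma normal_boundaries:
  assumes K: "chain_complex K"
  shows "boundaries K p \<lhd> cycle_group K p"
proof (rule comm_group.subgroup_imp_normal[OF comm_group_cycle_group])
  interpret comm_group "cycle_group K p"
    by (rule comm_group_cycle_group)
  show "subgroup (boundaries K p) (cycle_group K p)"
  proof (rule subgroupI)
    show "boundaries K p \<noteq> {}"
      using zero_in_boundaries by blast
    show "inv\<^bsub>cycle_group K p\<^esub> x \<in> boundaries K p" if "x \<in> boundaries K p" for x
      using that boundaries_cycles[OF K] inv_cycle_group by (metis subsetD)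
  qed (use boundaries_cycles[OF K] boundaries_add in auto)
qed

section \<open>Homology classes of representing cycles\<close>

definition homology_class :: "'c cell_complex \<Rightarrow> nat \<Rightarrow> ('c \<Rightarrow> bit) \<Rightarrow> ('c \<Rightarrow> bit) set" where
  "homology_class K p z = boundaries K p #>\<^bsub>cycle_group K p\<^esub> z"

lemma homology_class_eq_image: "homology_class K p z = (\<lambda>b a. b a + z a) ` boundaries K p"
  by (auto simp: homology_class_def r_coset_def)

lemma homology_class_self: "z \<in> homology_class K p z"
  unfolding homology_class_eq_image by (rule image_eqI[of _ _ "\<lambda>_. 0"]) auto

text \<open>The neutral element of the homology group is the coset \<open>boundaries K p\<close>
  itself, so this is the test for a class to vanish, used below to read off kernels.\<close>

lemma homology_class_eq_boundaries:
  "homology_class K p z = boundaries K p \<longleftrightarrow> z \<in> boundaries K p"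
proof
  assume "homology_class K p z = boundaries K p"
  then show "z \<in> boundaries K p"
    using homology_class_self[of z K p] by simp
next
  assume z: "z \<in> boundaries K p"
  then have "x \<in> homology_class K p z" if "x \<in> boundaries K p" for x
    unfolding homology_class_eq_image using that boundaries_add[OF z that]
    \<comment> \<open>The witness works because adding \<open>z\<close> to \<open>z + x\<close>
      gives back \<open>x\<close> in characteristic 2.\<close>
    by (intro image_eqI[of _ _ "\<lambda>a. z a + x a"]) (auto simp: add.commute add.left_commute)
  then show "homology_class K p z = boundaries K p"
    using z boundaries_add by (auto simp: homology_class_eq_image)
qed

lemma carrier_homology_group:
  "carrier (homology_group K p) = homology_class K p ` carrier (cycle_group K p)"
  by (auto simp: homology_group_def FactGroup_def RCOSETS_def homology_class_def)

lemma group_homology_group: "chain_complex K \<Longrightarrow> group (homology_group K p)"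
  unfolding homology_group_def by (intro normal.factorgroup_is_group normal_boundaries)

lemma one_homology_group [simp]: "\<one>\<^bsub>homology_group K p\<^esub> = boundaries K p"
  by (simp add: homology_group_def)

lemma homology_class_hom:
  "chain_complex K \<Longrightarrow> homology_class K p \<in> hom (cycle_group K p) (homology_group K p)"
  using normal.r_coset_hom_Mod[OF normal_boundaries]
  by (auto simp: homology_group_def homology_class_def[abs_def])

section \<open>Maps induced by inclusion and their images\<close>

lemma boundaries_restrict_to:
  assumes "chain_complex K" "closed_in K S"
  shows "boundaries (restrict_to K S) p \<subseteq> boundaries K p"
proof -
  have sub: "chains (restrict_to K S) q \<subseteq> chains K q" for q
    using assms by (intro chains_restrict_to_subset) (simp add: closed_in_def)
  then show ?thesis
    unfolding boundaries_def
    by (auto simp: boundary_restrict_to[OF assms] intro!: imageI subsetD[OF sub])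
qed

lemma cycles_restrict_to:
  assumes "chain_complex K" "closed_in K S"
  shows "carrier (cycle_group (restrict_to K S) p) \<subseteq> carrier (cycle_group K p)"
proof -
  have sub: "chains (restrict_to K S) q \<subseteq> chains K q" for q
    using assms by (intro chains_restrict_to_subset) (simp add: closed_in_def)
  then show ?thesis
    by (auto simp: carrier_cycle_group boundary_restrict_to[OF assms]
        intro: subsetD[OF sub])
qed

text \<open>Boundaries of the subcomplex are also boundaries of \<open>K\<close> and are absorbed by
  the larger coset, so the induced map keeps the representative.\<close>

lemma incl_hom_homology_class:
  assumes "chain_complex K" "closed_in K S"
  shows "incl_hom K p (homology_class (restrict_to K S) p z) = homology_class K p z"
proof -
  have "(\<lambda>a. b a + z a) \<in> incl_hom K p (homology_class (restrict_to K S) p z)"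
    if "b \<in> boundaries K p" for b
    using that homology_class_self[of z "restrict_to K S" p]
    by (auto simp: incl_hom_def set_mult_def)
  moreover have "(\<lambda>a. b a + (c a + z a)) \<in> homology_class K p z"
    if "b \<in> boundaries K p" "c \<in> boundaries (restrict_to K S) p" for b c
    unfolding homology_class_eq_image using that boundaries_restrict_to[OF assms]
    by (intro image_eqI[of _ _ "\<lambda>a. b a + c a"] boundaries_add) (auto simp: add.assoc)
  ultimately show ?thesis
    by (auto simp: incl_hom_def set_mult_def homology_class_eq_image)
qed

lemma carrier_persistent_homology_group:
  assumes "chain_complex K" "closed_in K S"
  shows "carrier (persistent_homology_group (restrict_to K S) K p) =
    homology_class K p ` carrier (cycle_group (restrict_to K S) p)"
  by (simp add: persistent_homology_group_def carrier_homology_group image_image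
      incl_hom_homology_class[OF assms])

text \<open>The extra surjection \<open>f\<close> allows persistent groups of different filtrations
  to be written as images of one common group \<open>G\<close>; it is later taken to be the identity
  and the projection \<open>remove_part\<close>.\<close>

lemma group_hom_persistent:
  assumes K: "chain_complex K" and S: "closed_in K S" and G: "group G"
    and f: "f \<in> hom G (cycle_group (restrict_to K S) p)"
    and surj: "f ` carrier G = carrier (cycle_group (restrict_to K S) p)"
  shows "group_hom G (persistent_homology_group (restrict_to K S) K p) (homology_class K p \<circ> f)"
    and "(homology_class K p \<circ> f) ` carrier G =
      carrier (persistent_homology_group (restrict_to K S) K p)"
proof -
  let ?P = "persistent_homology_group (restrict_to K S) K p"
  let ?h = "homology_class K p \<circ> f"
  have "f \<in> hom G (cycle_group K p)"
    using f cycles_restrict_to[OF K S] by (fastforce simp: hom_def)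
  then have h: "?h \<in> hom G (homology_group K p)"
    using homology_class_hom[OF K] by (rule hom_compose)
  show img: "?h ` carrier G = carrier ?P"
    by (simp only: carrier_persistent_homology_group[OF K S] surj[symmetric] image_comp)
  interpret H: group_hom G "homology_group K p" ?h
    using G group_homology_group[OF K] h by (simp add: group_hom_def group_hom_axioms_def)
  \<comment> \<open>Written as the image of \<open>?h\<close>, the persistent group is visibly a
    subgroup of the homology group.\<close>
  have P: "?P = (homology_group K p)\<lparr>carrier := ?h ` carrier G\<rparr>"
    unfolding img by (simp add: persistent_homology_group_def)
  have "group ?P"
    unfolding P by (rule subgroup.subgroup_is_group[OF H.img_is_subgroup H.H.is_group])
  moreover have "?h \<in> hom G ?P"
    using h unfolding P by (simp add: hom_def)
  ultimately show "group_hom G ?P ?h"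
    using G by (simp add: group_hom_def group_hom_axioms_def)
qed

text \<open>By the first isomorphism theorem both images are isomorphic to the quotient of
  \<open>G\<close> by the common kernel.\<close>

lemma iso_images_of_equal_kernels:
  assumes f: "group_hom G H f" and g: "group_hom G H' g"
    and f_surj: "f ` carrier G = carrier H" and g_surj: "g ` carrier G = carrier H'"
    and ker: "kernel G H f = kernel G H' g"
  shows "H \<cong> H'"
proof -
  have "group (G Mod kernel G H f)"
    by (intro normal.factorgroup_is_group group_hom.normal_kernel f)
  then have "H \<cong> G Mod kernel G H f"
    using group_hom.FactGroup_iso[OF f f_surj] by (rule group.iso_sym)
  also have "\<dots> \<cong> H'"
    unfolding ker by (rule group_hom.FactGroup_iso[OF g g_surj])
  finally show ?thesis .
qed

section \<open>Removing an acyclic subcomplex\<close>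

text \<open>Acyclicity at the level of chains. For \<open>p > 0\<close> it is the vanishing of the
  homology of \<open>A\<close>; for \<open>p = 0\<close> it is injectivity of the map from H_0(A) to
  H_0(K), which is why \<open>z\<close> must then bound in \<open>K\<close>.\<close>

lemma acyclic_cycle_bounds:
  assumes K: "chain_complex K" and A: "acyclic_subcomplex K A"
    and z: "z \<in> chains (restrict_to K A) p" "boundary K z = (\<lambda>_. 0)"
    and zero: "p = 0 \<Longrightarrow> z \<in> boundaries K 0"
  shows "z \<in> boundaries (restrict_to K A) p"
proof -
  let ?A = "restrict_to K A"
  have cl: "closed_in K A"
    using A by (simp add: acyclic_subcomplex_def)
  have zc: "z \<in> carrier (cycle_group ?A p)"
    using z boundary_restrict_to[OF K cl z(1)] by (simp add: carrier_cycle_group)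
  then have hz: "homology_class ?A p z \<in> carrier (homology_group ?A p)"
    by (simp add: carrier_homology_group)
  have "homology_class ?A p z = boundaries ?A p"
  proof (cases "p = 0")
    case True
    have "(\<lambda>_. 0) \<in> carrier (cycle_group ?A 0)"
      by (simp add: carrier_cycle_group)
    then have "homology_class ?A 0 (\<lambda>_. 0) \<in> carrier (homology_group ?A 0)"
      by (simp add: carrier_homology_group)
    \<comment> \<open>Both \<open>z\<close> and the zero chain bound in \<open>K\<close>, so both
      classes go to the zero class.\<close>
    moreover have "incl_hom K 0 (homology_class ?A 0 z) = incl_hom K 0 (homology_class ?A 0 (\<lambda>_. 0))"
      using zero[OF True] homology_class_eq_boundaries[of K 0 z]
        homology_class_eq_boundaries[of K 0 "\<lambda>_. 0"]
      by (simp add: incl_hom_homology_class[OF K cl])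
    ultimately have "homology_class ?A 0 z = homology_class ?A 0 (\<lambda>_. 0)"
      using A hz True unfolding acyclic_subcomplex_def by (metis inj_onD)
    then show ?thesis
      using True homology_class_eq_boundaries[of ?A 0 "\<lambda>_. 0"] by simp
  next
    case False
    then show ?thesis
      using A hz by (auto simp: acyclic_subcomplex_def trivial_group_def)
  qed
  then show ?thesis
    by (simp add: homology_class_eq_boundaries)
qed

text \<open>A relative cycle \<open>w\<close> has its boundary in \<open>A\<close>. This boundary is
  a cycle of \<open>A\<close>, hence the boundary of some chain \<open>a\<close> of
  \<open>A\<close>, and \<open>w + a\<close> is a cycle of \<open>K\<close> that agrees with
  \<open>w\<close> outside \<open>A\<close>.\<close>

lemma cycle_lift:
  assumes K: "chain_complex K" and A: "acyclic_subcomplex K A" and "l > 0"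
    and w: "w \<in> carrier (cycle_group (remove_cells K A) l)"
  obtains z where "z \<in> carrier (cycle_group K l)" "remove_part A z = w"
proof -
  have cl: "closed_in K A"
    using A by (simp add: acyclic_subcomplex_def)
  obtain p where p: "l = Suc p"
    using \<open>l > 0\<close> gr0_implies_Suc by blast
  have w': "w \<in> chains (remove_cells K A) l" "boundary (remove_cells K A) w = (\<lambda>_. 0)"
    using w by (auto simp: carrier_cycle_group)
  then have wK: "w \<in> chains K l"
    using chains_remove_cells_subset by blast
  have "remove_part A (boundary K w) = (\<lambda>_. 0)"
    using boundary_remove_cells[OF K cl, of w] w' by (simp add: remove_part_id)
  then have "boundary K w \<in> chains (restrict_to K A) p"
    using boundary_chains[OF K] wK p chains_restrict_toI by blast
  \<comment> \<open>This is the case \<open>l = 1\<close>: the 0-cycle of \<open>A\<close> bounds in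
    \<open>K\<close> because it is the boundary of \<open>w\<close>.\<close>
  moreover have "boundary K w \<in> boundaries K 0" if "p = 0"
    using wK p that by (simp add: boundaries_def)
  ultimately have "boundary K w \<in> boundaries (restrict_to K A) p"
    using boundary_boundary[OF K wK] by (intro acyclic_cycle_bounds[OF K A])
  then obtain a where a: "a \<in> chains (restrict_to K A) l"
    and bw: "boundary K w = boundary (restrict_to K A) a"
    by (auto simp: boundaries_def p)
  have aK: "a \<in> chains K l"
    using a cl chains_restrict_to_subset by (auto simp: closed_in_def)
  \<comment> \<open>Equal boundaries cancel in characteristic 2, so the sum of the two chains is a
    cycle.\<close>
  have "boundary K a = boundary K w"
    using bw boundary_restrict_to[OF K cl a] by simp
  then have "(\<lambda>c. w c + a c) \<in> carrier (cycle_group K l)"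
    using wK aK by (simp add: carrier_cycle_group chains_add boundary_add)
  moreover have "remove_part A a = (\<lambda>_. 0)"
    using a by (force simp: chains_def remove_part_def)
  then have "remove_part A (\<lambda>c. w c + a c) = w"
    using w' by (simp add: remove_part_add remove_part_id)
  ultimately show ?thesis
    using that by blast
qed

text \<open>Injectivity of the projection in homology. If the projection of \<open>z\<close> is the
  relative boundary of \<open>w\<close>, then \<open>z\<close> differs from
  \<open>boundary K w\<close> by a cycle of \<open>A\<close>, and this bounds in \<open>A\<close> by
  acyclicity.\<close>

lemma remove_part_boundary_iff:
  assumes K: "chain_complex K" and A: "acyclic_subcomplex K A" and "l > 0"
    and z: "z \<in> carrier (cycle_group K l)"
  shows "remove_part A z \<in> boundaries (remove_cells K A) l \<longleftrightarrow> z \<in> boundaries K l"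
proof
  have cl: "closed_in K A"
    using A by (simp add: acyclic_subcomplex_def)
  {
    assume "z \<in> boundaries K l"
    then show "remove_part A z \<in> boundaries (remove_cells K A) l"
      by (auto simp: boundaries_def boundary_remove_cells[OF K cl, symmetric]
          intro!: imageI remove_part_chains)
  next
    assume "remove_part A z \<in> boundaries (remove_cells K A) l"
    then obtain w where w: "w \<in> chains (remove_cells K A) (Suc l)"
      and zw: "remove_part A z = boundary (remove_cells K A) w"
      by (auto simp: boundaries_def)
    have wK: "w \<in> chains K (Suc l)"
      using w chains_remove_cells_subset by blast
    then have bw: "boundary K w \<in> boundaries K l"
      by (simp add: boundaries_def)
    have bwz: "boundary K w \<in> carrier (cycle_group K l)"
      using bw boundaries_cycles[OF K] by blast
    let ?y = "\<lambda>c. z c + boundary K w c"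
    have "remove_part A (boundary K w) = remove_part A z"
      using boundary_remove_cells[OF K cl, of w] zw by (simp add: remove_part_id[OF w])
    then have "?y \<in> chains (restrict_to K A) l"
      using z bwz by (intro chains_restrict_toI) (auto simp: carrier_cycle_group chains_add remove_part_add)
    then have "?y \<in> boundaries (restrict_to K A) l"
      \<comment> \<open>In positive dimension the side condition on 0-chains is vacuous.\<close>
      using \<open>l > 0\<close> z bwz
      by (intro acyclic_cycle_bounds[OF K A]) (auto simp: carrier_cycle_group boundary_add)
    then have "?y \<in> boundaries K l"
      using boundaries_restrict_to[OF K cl] by blast
    from boundaries_add[OF this bw] show "z \<in> boundaries K l"
      by (simp add: add.assoc)
  }
qed

text \<open>Here \<open>K\<close> is the later stage and \<open>S\<close> holds the cells of the
  earlier one. Acyclicity in the earlier stage makes the projection onto on cycles; acyclicity in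
  the later stage makes the kernels agree.\<close>

lemma persistent_homology_group_iso:
  assumes K: "chain_complex K" and S: "closed_in K S"
    and AS: "acyclic_subcomplex (restrict_to K S) (S \<inter> A)" and A: "acyclic_subcomplex K A"
    and l: "l > 0"
  shows "persistent_homology_group (restrict_to K S) K l \<cong>
    persistent_homology_group (remove_cells (restrict_to K S) (S \<inter> A)) (remove_cells K A) l"
proof -
  let ?X = "restrict_to K S"
  let ?Y' = "remove_cells K A"
  \<comment> \<open>Restricting and removing commute, which exhibits the earlier complement as a
    subcomplex of the later one.\<close>
  have X'_eq: "remove_cells ?X (S \<inter> A) = restrict_to ?Y' (S - A)"
    by (simp add: remove_cells_def restrict_to_def Diff_Int)
  let ?X' = "restrict_to ?Y' (S - A)"
  have X: "chain_complex ?X"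
    by (rule chain_complex_restrict_to[OF K S])
  have clA: "closed_in K A" and clAS: "closed_in ?X (S \<inter> A)"
    using A AS by (simp_all add: acyclic_subcomplex_def)
  have Y': "chain_complex ?Y'"
    by (rule chain_complex_remove_cells[OF K clA])
  have clS': "closed_in ?Y' (S - A)"
    using S by (auto simp: closed_in_def is_face_def)
  have G: "group (cycle_group ?X l)"
    using comm_group_cycle_group comm_group.axioms(2) by blast
  \<comment> \<open>On chains supported in \<open>S\<close> the projections of the two stages
    coincide, so the boundary test in the later stage applies to \<open>?r\<close>.\<close>
  have res_eq: "remove_part (S \<inter> A) z = remove_part A z" if "z \<in> chains ?X l" for z
    using that by (force simp: chains_def remove_part_def)
  let ?r = "remove_part (S \<inter> A)"
  have r_cycle: "?r z \<in> carrier (cycle_group ?X' l)" if "z \<in> carrier (cycle_group ?X l)" for z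
    using that remove_part_chains[of z ?X l "S \<inter> A"] boundary_remove_cells[OF X clAS, of z]
    by (simp add: carrier_cycle_group X'_eq)
  have r_hom: "?r \<in> hom (cycle_group ?X l) (cycle_group ?X' l)"
    using r_cycle by (auto simp: hom_def remove_part_add)
  have r_surj: "?r ` carrier (cycle_group ?X l) = carrier (cycle_group ?X' l)"
  proof
    show "carrier (cycle_group ?X' l) \<subseteq> ?r ` carrier (cycle_group ?X l)"
      by (metis X'_eq cycle_lift[OF X AS l] image_eqI subsetI)
  qed (use r_cycle in blast)
  have id_hom: "id \<in> hom (cycle_group ?X l) (cycle_group ?X l)"
    by (simp add: hom_def)
  have "z \<in> boundaries K l \<longleftrightarrow> ?r z \<in> boundaries ?Y' l" if z: "z \<in> carrier (cycle_group ?X l)" for z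
    using remove_part_boundary_iff[OF K A l] z cycles_restrict_to[OF K S] res_eq
    by (metis carrier_cycle_group subsetD)
  then have ker: "kernel (cycle_group ?X l) (persistent_homology_group ?X K l) (homology_class K l \<circ> id) =
    kernel (cycle_group ?X l) (persistent_homology_group ?X' ?Y' l) (homology_class ?Y' l \<circ> ?r)"
    by (auto simp: kernel_def persistent_homology_group_def homology_class_eq_boundaries)
  show ?thesis
    unfolding X'_eq
    using group_hom_persistent[OF K S G id_hom] group_hom_persistent[OF Y' clS' G r_hom r_surj] ker
    by (intro iso_images_of_equal_kernels) auto
qed

section \<open>From isomorphic groups to Betti numbers and intervals\<close>

lemma group_persistent_homology_group:
  assumes K: "chain_complex K" and S: "closed_in K S"
  shows "group (persistent_homology_group (restrict_to K S) K p)"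
proof -
  have "group (cycle_group (restrict_to K S) p)"
    using comm_group_cycle_group comm_group.axioms(2) by blast
  moreover have "id \<in> hom (cycle_group (restrict_to K S) p) (cycle_group (restrict_to K S) p)"
    by (simp add: hom_def)
  ultimately show ?thesis
    using group_hom_persistent(1)[OF K S, of _ id] by (auto simp: group_hom_def)
qed

text \<open>Isomorphic groups are isomorphic to the same powers of Z_2, so the two definite
  descriptions have equivalent predicates.\<close>

lemma Z2_dim_cong:
  assumes "group G" "G \<cong> H"
  shows "Z2_dim G = Z2_dim H"
proof -
  have "G \<cong> Z2_power d \<longleftrightarrow> H \<cong> Z2_power d" for d
    using iso_trans[OF assms(2)] iso_trans[OF group.iso_sym[OF assms]] by blast
  then show ?thesis
    by (simp add: Z2_dim_def)
qed

lemma closed_in_sublevel: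
  assumes "filtering_function K n g"
  shows "closed_in K {c \<in> cells K. g c \<le> int i}"
  using assms by (force simp: closed_in_def filtering_function_def is_face_def)

lemma persistent_betti_remove_acyclic:
  assumes K: "chain_complex K" and g: "filtering_function K n g"
    and A: "acyclic_compatible K n g A" and l: "l > 0" and ij: "i \<le> j" "j \<le> n"
  shows "persistent_betti (\<lambda>i. sublevel K g i) l i j =
    persistent_betti (\<lambda>i. remove_cells (sublevel K g i) (cells (sublevel K g i) \<inter> A)) l i j"
proof -
  define S where "S i = {c \<in> cells K. g c \<le> int i}" for i
  have sub: "sublevel K g i = restrict_to K (S i)" for i
    by (simp add: sublevel_def S_def)
  have clS: "closed_in K (S i)" for i
    using closed_in_sublevel[OF g] by (simp add: S_def)
  have SS: "S i \<subseteq> S j"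
    using ij by (auto simp: S_def)
  \<comment> \<open>Stage \<open>j\<close> serves as the ambient complex, with stage
    \<open>i\<close> as a closed subset of it.\<close>
  let ?Y = "restrict_to K (S j)"
  have Y: "chain_complex ?Y"
    by (rule chain_complex_restrict_to[OF K clS])
  have X_eq: "restrict_to K (S i) = restrict_to ?Y (S i)"
    by simp
  have clY: "closed_in ?Y (S i)"
    using SS clS[of i] S_def[of j] by (auto simp: closed_in_def is_face_def)
  have ac: "acyclic_subcomplex (restrict_to K (S k)) (S k \<inter> A)" if "k \<le> n" for k
    using A that by (simp add: acyclic_compatible_def sub)
  \<comment> \<open>The set removed at stage \<open>i\<close> must be expressed through the one
    removed from the ambient stage \<open>j\<close>.\<close>
  have int_eq: "S i \<inter> A = S i \<inter> (S j \<inter> A)"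
    using SS by blast
  have "persistent_homology_group (restrict_to ?Y (S i)) ?Y l \<cong>
    persistent_homology_group (remove_cells (restrict_to ?Y (S i)) (S i \<inter> (S j \<inter> A)))
      (remove_cells ?Y (S j \<inter> A)) l"
    using ac[of i] ac[of j] ij int_eq
    by (intro persistent_homology_group_iso[OF Y clY _ _ l]) auto
  then show ?thesis
    using Z2_dim_cong[OF group_persistent_homology_group[OF Y clY]] int_eq
    by (simp add: persistent_betti_def sub)
qed

theorem theorem5p3:
  fixes K :: "'c cell_complex" and g :: "'c \<Rightarrow> int" and A :: "'c set" and n l :: nat
  assumes "chain_complex K"
    and "filtering_function K n g"
    and "acyclic_compatible K n g A"
    and "l > 0"
  shows "persistence (\<lambda>i. sublevel K g i) n l =
         persistence (\<lambda>i. remove_cells (sublevel K g i) (cells (sublevel K g i) \<inter> A)) n l"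
proof -
  have "born_alive (\<lambda>i. sublevel K g i) l i j =
    born_alive (\<lambda>i. remove_cells (sublevel K g i) (cells (sublevel K g i) \<inter> A)) l i j"
    if "i \<le> j" "j \<le> n" for i j
    using persistent_betti_remove_acyclic[OF assms] that by (simp add: born_alive_def)
  then show ?thesis
    unfolding persistence_def
    \<comment> \<open>The multiplicities involve only the index pairs \<open>(i, j - 1)\<close> and
      \<open>(i, j)\<close> with \<open>i < j \<le> n\<close>, and \<open>(i, n)\<close>; in each
      the first index is at most the second, since \<open>i \<le> j - 1\<close>.\<close>
    by (intro arg_cong2[where f = "(+)"] sum.cong refl) auto
qed

end
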